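(* Let $N\ge 1$ be an integer, let $f:\mathbb{S}^2\to\mathbb{C}$, and let $X'=\{\xi_{kj}: k=1,\dots,N,\ j=0,\dots,2N\}\subset\mathbb{S}^2$ be the nodal set with weights $\mu_N(\xi_{kj})$ described in the context; put $L=N(2N+1)$. Index rows by the pairs $(k,j)$ with $1\le k\le N$, $0\le j\le 2N$, and columns by the pairs $(n,k')$ with $0\le n\le N-1$, $-n\le k'\le n$. Let $\mathbf{\Phi}\in\mathbb{C}^{L\times N^2}$ be the matrix with entries $Y_{nk'}(\xi_{kj})$, let $I_N\in\mathbb{R}^{L\times L}$ be the diagonal matrix with diagonal entries $\sqrt{\mu_N(\xi_{kj})}$, and set $\mathbf{\Phi}_1=I_N\mathbf{\Phi}$, $\mathbf{f}=(f(\xi_{kj}))_{(k,j)}\in\mathbb{C}^L$, $\mathbf{f}_1=I_N\mathbf{f}$. Then $(I_N\mathbf{\Phi})^H(I_N\mathbf{\Phi})$ is the $N^2\times N^2$ identity matrix. Consequently the solution $\tilde{\mathbf a}\in\mathbb{C}^{N^2}$ of the weighted minimum problem $$\|\mathbf{f}_1-\mathbf{\Phi}_1\tilde{\mathbf a}\|_2=\min_{\mathbf a\in\mathbb{C}^{N^2}}\|\mathbf{f}_1-\mathbf{\Phi}_1\mathbf a\|_2$$ is $\tilde{\mathbf a}=(I_N\mathbf{\Phi})^H\mathbf{f}_1$, that is, its components are the discrete Laplace--Fourier coefficients of $f$: $$\tilde a_{nk'}=\int_X \overline{Y_{nk'}}\,f\,d\mu_N,\qquad 0\le n\le N-1,\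 -n\le k'\le n,$$ and the component with index $(k,j)$ of the best approximant $\mathbf{\Phi}_1\tilde{\mathbf a}$ equals $$\sqrt{\mu_N(\xi_{kj})}\int_X\sum_{n=0}^{N-1}K_n(\xi_{kj},\eta)\,f(\eta)\,d\mu_N(\eta).$$
   Context: $\mathbb{S}^2$ is the unit sphere in $\mathbb{R}^3$, with points written $(\sin\theta\cos\varphi,\sin\theta\sin\varphi,\cos\theta)$, $\theta\in[0,\pi]$, $\varphi\in[0,2\pi]$; functions on $\mathbb{S}^2$ are identified with functions of $(\theta,\varphi)$. $\|\cdot\|_2$ is the Euclidean norm and $A^H$ is the conjugate transpose. Spherical functions: for $n\ge 0$ and $-n\le k\le n$, $Y_{nk}(\theta,\varphi)=\sqrt{2n+1}\,P_n^{|k|}(\cos\theta)e^{ik\varphi}$, where $P_n$ is the Legendre polynomial of degree $n$ (with $P_n(1)=1$) and $P_n^{|k|}(x)=\sqrt{\frac{(n-|k|)!}{(n+|k|)!}}\,(1-x^2)^{|k|/2}\frac{d^{|k|}}{dx^{|k|}}P_n(x)$ is the associated Legendre function, normalized so that the $Y_{nk}$ are orthonormal for the scalar product $\langle f,g\rangle=\frac1{4\pi}\int_0^{2\pi}\int_0^{\pi}f\,\overline{g}\,\sin\theta\,d\theta\,d\varphi$. The reproducing kernel is $K_n(\xi,\eta)=\sum_{k=-n}^n Y_{nk}(\xi)\overline{Y_{nk}(\eta)}=(2n+1)P_n(\xi\cdot\eta)$ for $\xi,\eta\in\mathbb{S}^2$. Nodal points and weights: let $\lambda_1^N,\dots,\lambda_N^N\in(-1,1)$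 be the roots of $P_N$, let $l_k^N$ be the Lagrange fundamental polynomials of degree $N-1$ with $l_k^N(\lambda_i^N)=\delta_{ki}$, and let $\mathcal{A}_k^N=\int_{-1}^1 l_k^N(x)\,dx>0$ be the Christoffel numbers. Put $\theta_k=\arccos\lambda_k^N$ ($1\le k\le N$), $\varphi_j=\frac{2\pi j}{2N+1}$ ($0\le j\le 2N$), $X=\{(\theta_k,\varphi_j)\}$, $\xi_{kj}=(\sin\theta_k\cos\varphi_j,\sin\theta_k\sin\varphi_j,\cos\theta_k)$, $X'=\{\xi_{kj}\}$ (identified with $X$), and $\mu_N(\xi_{kj})=\frac{\mathcal{A}_k^N}{2(2N+1)}$. The discrete integral is $\int_X F\,d\mu_N=\sum_{k=1}^N\sum_{j=0}^{2N}F(\xi_{kj})\mu_N(\xi_{kj})$. *)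

theory Defs
  imports
    "HOL-Analysis.Analysis"
    "HOL-Computational_Algebra.Polynomial"
    "Jordan_Normal_Form.Schur_Decomposition"
begin

section \<open>Legendre polynomials and spherical functions\<close>

text \<open>Rodrigues' formula; this is the normalization with value 1 at 1.\<close>

definition legendre :: "nat \<Rightarrow> real poly" where
  "legendre n = Polynomial.smult (1 / (2 ^ n * fact n)) ((pderiv ^^ n) ([:- 1, 0, 1:] ^ n))"

text \<open>
  The factor \<open>(1 - x\<^sup>2)\<^bsup>m/2\<^esup>\<close> is written as a power of the square root, because
  \<open>0 powr 0 = 0\<close> would give the wrong value for \<open>m = 0\<close> at the poles.
\<close>

definition assoc_legendre :: "nat \<Rightarrow> nat \<Rightarrow> real \<Rightarrow> real" where
  "assoc_legendre n m x =
     sqrt (fact (n - m) / fact (n + m)) * sqrt (1 - x\<^sup>2) ^ m * poly ((pderiv ^^ m) (legendre n)) x"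

text \<open>
  Functions on the sphere are identified with functions of the pair of angles
  \<open>(\<theta>, \<phi>)\<close>; a function given on the sphere itself is pulled back along \<open>sphere_point\<close>.
\<close>

definition sphere_point :: "real \<times> real \<Rightarrow> real ^ 3" where
  "sphere_point = (\<lambda>(\<theta>, \<phi>). vector [sin \<theta> * cos \<phi>, sin \<theta> * sin \<phi>, cos \<theta>])"

definition sphY :: "nat \<Rightarrow> int \<Rightarrow> real \<times> real \<Rightarrow> complex" where
  "sphY n k = (\<lambda>(\<theta>, \<phi>).
     complex_of_real (sqrt (2 * real n + 1) * assoc_legendre n (nat \<bar>k\<bar>) (cos \<theta>))
       * exp (\<i> * of_int k * complex_of_real \<phi>))"

definition sphK :: "nat \<Rightarrow> real \<times> real \<Rightarrow> real \<times> real \<Rightarrow> complex" where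
  "sphK n \<xi> \<eta> = (\<Sum>k\<in>{- int n..int n}. sphY n k \<xi> * cnj (sphY n k \<eta>))"


section \<open>Nodes, weights and the discrete integral\<close>

text \<open>
  Here and below, \<open>lam 1, \<dots>, lam N\<close> are the interpolation nodes on the line
  (later: the roots of \<open>legendre N\<close>).
\<close>

definition lagrange_fund :: "nat \<Rightarrow> (nat \<Rightarrow> real) \<Rightarrow> nat \<Rightarrow> real poly" where
  "lagrange_fund N lam k =
     (THE l. degree l = N - 1 \<and> (\<forall>i\<in>{1..N}. poly l (lam i) = (if i = k then 1 else 0)))"

text \<open>The description above is proper for pairwise distinct nodes.\<close>

lemma lagrange_fund_ex1:
  assumes inj: "inj_on lam {1..N}" and k: "k \<in> {1..N}"
  shows "\<exists>!l. degree l = N - 1 \<and>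
           (\<forall>i\<in>{1..N}. poly l (lam i) = (if i = k then 1 else (0::real)))"
proof (rule ex_ex1I)
  define q where "q = (\<Prod>i\<in>{1..N} - {k}. [:- lam i, 1:])"
  have pq: "poly q x = (\<Prod>i\<in>{1..N} - {k}. x - lam i)" for x
    by (simp add: q_def poly_prod)
  have "lam k - lam i \<noteq> 0" if "i \<in> {1..N} - {k}" for i
    using inj_onD[OF inj, of k i] k that by fastforce
  hence ne: "poly q (lam k) \<noteq> 0"
    by (simp only: pq prod_zero_iff[OF finite_Diff[OF finite_atLeastAtMost]]) blast
  have z: "poly q (lam i) = 0" if "i \<in> {1..N}" "i \<noteq> k" for i
    unfolding pq by (rule prod_zero) (use that in auto)
  have "degree q = (\<Sum>i\<in>{1..N} - {k}. degree [:- lam i, 1:])"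
    unfolding q_def by (rule degree_prod_eq_sum_degree) simp
  also have "\<dots> = N - 1"
    using k by simp
  finally have "degree (Polynomial.smult (1 / poly q (lam k)) q) = N - 1"
    using ne by simp
  moreover have "poly (Polynomial.smult (1 / poly q (lam k)) q) (lam i) = (if i = k then 1 else 0)"
    if "i \<in> {1..N}" for i
    using ne z[OF that] by (cases "i = k") simp_all
  ultimately show "\<exists>l. degree l = N - 1 \<and>
      (\<forall>i\<in>{1..N}. poly l (lam i) = (if i = k then 1 else (0::real)))"
    by blast
next
  fix l m
  assume l: "degree l = N - 1 \<and> (\<forall>i\<in>{1..N}. poly l (lam i) = (if i = k then 1 else (0::real)))"
    and m: "degree m = N - 1 \<and> (\<forall>i\<in>{1..N}. poly m (lam i) = (if i = k then 1 else (0::real)))"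
  have c: "card (lam ` {1..N}) = N"
    using inj by (simp add: card_image)
  have "N > 0"
    using k by simp
  show "l = m"
  proof (rule poly_eqI_degree[where A = "lam ` {1..N}"])
    fix x assume "x \<in> lam ` {1..N}"
    then obtain i where "i \<in> {1..N}" "x = lam i"
      by blast
    thus "poly l x = poly m x"
      using l m by metis
  next
    show "degree l < card (lam ` {1..N})" "degree m < card (lam ` {1..N})"
      unfolding c using l m \<open>N > 0\<close> by simp_all
  qed
qed

definition christoffel :: "nat \<Rightarrow> (nat \<Rightarrow> real) \<Rightarrow> nat \<Rightarrow> real" where
  "christoffel N lam k = integral {- 1..1} (poly (lagrange_fund N lam k))"

definition node :: "nat \<Rightarrow> (nat \<Rightarrow> real) \<Rightarrow> nat \<times> nat \<Rightarrow> real \<times> real" where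
  "node N lam = (\<lambda>(k, j). (arccos (lam k), 2 * pi * real j / (2 * real N + 1)))"

definition weight :: "nat \<Rightarrow> (nat \<Rightarrow> real) \<Rightarrow> nat \<times> nat \<Rightarrow> real" where
  "weight N lam = (\<lambda>(k, j). christoffel N lam k / (2 * (2 * real N + 1)))"

definition discrete_integral ::
  "nat \<Rightarrow> (nat \<Rightarrow> real) \<Rightarrow> (real \<times> real \<Rightarrow> complex) \<Rightarrow> complex" where
  "discrete_integral N lam F =
     (\<Sum>k=1..N. \<Sum>j=0..2 * N. F (node N lam (k, j)) * complex_of_real (weight N lam (k, j)))"


section \<open>The weighted least squares problem\<close>

text \<open>
  Library matrices and vectors are indexed by natural numbers, so rows and columns are
  numbered through enumerations \<open>\<rho>\<close> and \<open>\<kappa>\<close> of the sets of index pairs; which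
  enumeration is used is left open.
\<close>

definition row_indices :: "nat \<Rightarrow> (nat \<times> nat) set" where
  "row_indices N = {1..N} \<times> {0..2 * N}"

definition col_indices :: "nat \<Rightarrow> (nat \<times> int) set" where
  "col_indices N = (SIGMA n:{..<N}. {- int n..int n})"

definition Phi ::
  "nat \<Rightarrow> (nat \<Rightarrow> real) \<Rightarrow> (nat \<Rightarrow> nat \<times> nat) \<Rightarrow> (nat \<Rightarrow> nat \<times> int) \<Rightarrow> complex mat" where
  "Phi N lam \<rho> \<kappa> = Matrix.mat (N * (2 * N + 1)) (N\<^sup>2)
     (\<lambda>(r, c). sphY (fst (\<kappa> c)) (snd (\<kappa> c)) (node N lam (\<rho> r)))"

definition sqrt_weight_mat ::
  "nat \<Rightarrow> (nat \<Rightarrow> real) \<Rightarrow> (nat \<Rightarrow> nat \<times> nat) \<Rightarrow> complex mat" where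
  "sqrt_weight_mat N lam \<rho> =
     mat_diag (N * (2 * N + 1)) (\<lambda>r. complex_of_real (sqrt (weight N lam (\<rho> r))))"

definition sample_vec ::
  "nat \<Rightarrow> (nat \<Rightarrow> real) \<Rightarrow> (nat \<Rightarrow> nat \<times> nat) \<Rightarrow> (real ^ 3 \<Rightarrow> complex) \<Rightarrow> complex Matrix.vec" where
  "sample_vec N lam \<rho> f =
     Matrix.vec (N * (2 * N + 1)) (\<lambda>r. f (sphere_point (node N lam (\<rho> r))))"

definition norm2 :: "complex Matrix.vec \<Rightarrow> real" where
  "norm2 v = L2_set (\<lambda>i. cmod (v $ i)) {..<dim_vec v}"

end

theory Submission
  imports Defs
begin

text \<open>
  The Legendre equation makes \<open>q \<mapsto> ((1 - x\<^sup>2) q')'\<close> a self-adjoint operator with eigenfunction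
  \<open>P\<^sub>N\<close>, which gives orthogonality to lower degrees; its derivatives form a ladder in \<open>m\<close> that
  reduces the norms of the associated Legendre functions to the case \<open>m = 0\<close>. Products of two
  spherical functions of degree less than \<open>N\<close> and equal order \<open>k\<close> are polynomials of degree at
  most \<open>2N - 2\<close> in \<open>cos \<theta>\<close>, so Gauss quadrature is exact on them, while different orders are
  separated by the equidistant sum in \<open>\<phi>\<close>. Thus the weighted matrix has orthonormal columns, and
  the least squares problem is solved by Pythagoras.
\<close>

section \<open>Integrals of polynomials over [-1, 1]\<close>

text \<open>Taken on polynomials rather than functions, so that integrability is automatic and
  integration by parts becomes a plain equation.\<close>

definition poly_integral :: "real poly \<Rightarrow> real" where
  "poly_integral p = integral {- 1..1} (poly p)"

lemma poly_integrable: "poly p integrable_on {- 1..1::real}"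
  by (intro integrable_continuous_real continuous_intros)

lemma poly_integral_add: "poly_integral (p + q) = poly_integral p + poly_integral q"
  unfolding poly_integral_def poly_add by (intro integral_add poly_integrable)

lemma poly_integral_smult: "poly_integral (Polynomial.smult c p) = c * poly_integral p"
  unfolding poly_integral_def poly_smult by simp

lemma poly_integral_diff: "poly_integral (p - q) = poly_integral p - poly_integral q"
  unfolding poly_integral_def poly_diff by (intro integral_diff poly_integrable)

lemma poly_integral_0 [simp]: "poly_integral 0 = 0"
  using poly_integral_smult[of 0 0] by simp

lemma poly_integral_sum: "poly_integral (\<Sum>i\<in>A. g i) = (\<Sum>i\<in>A. poly_integral (g i))"
  by (induction A rule: infinite_finite_induct) (simp_all add: poly_integral_add)

lemma poly_integral_pderiv: "poly_integral (pderiv p) = poly p 1 - poly p (- 1)"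
proof -
  have "(poly (pderiv p) has_integral poly p 1 - poly p (- 1)) {- 1..1}"
    by (rule fundamental_theorem_of_calculus)
      (auto simp: has_real_derivative_iff_has_vector_derivative [symmetric]
        intro: DERIV_subset [OF poly_DERIV])
  thus ?thesis
    unfolding poly_integral_def by (rule integral_unique)
qed

text \<open>A nonnegative continuous function with zero integral vanishes on the whole interval,
  which would give \<open>p\<close> infinitely many roots.\<close>

lemma poly_integral_pos:
  assumes nonneg: "\<And>x. x \<in> {- 1..1} \<Longrightarrow> 0 \<le> poly p x" and "p \<noteq> 0"
  shows "0 < poly_integral p"
proof -
  have ge: "0 \<le> poly_integral p"
    unfolding poly_integral_def by (intro integral_nonneg poly_integrable nonneg)
  have "poly_integral p \<noteq> 0"
  proof
    assume "poly_integral p = 0"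
    hence "(poly p has_integral 0) (cbox (- 1) 1)"
      using poly_integrable[of p] unfolding poly_integral_def
      by (metis box_real(2) integrable_integral)
    hence "poly p x = 0" if "x \<in> {- 1..1}" for x
      using has_integral_0_cbox_imp_0[of "- 1" 1 "poly p" x] nonneg that
        continuous_on_poly[OF continuous_on_id, of "{- 1..1}" p]
      by (auto simp: box_real)
    hence "{- 1..1::real} \<subseteq> {x. poly p x = 0}"
      by blast
    moreover have "infinite {- 1..1::real}"
      by (simp add: infinite_Icc)
    ultimately show False
      using poly_roots_finite[OF \<open>p \<noteq> 0\<close>] finite_subset by blast
  qed
  with ge show ?thesis by simp
qed

section \<open>Legendre polynomials\<close>

text \<open>For u = (x^2 - 1)^n one has (x^2 - 1) u' = 2 n x u; differentiating this k + 1 times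
  gives the recurrence.\<close>

lemma rodrigues_ode:
  fixes x :: real
  defines "U \<equiv> \<lambda>n k. (pderiv ^^ k) ([:- 1, 0, 1:] ^ n :: real poly)"
  shows "(x\<^sup>2 - 1) * poly (U n (k + 2)) x + 2 * (real k + 1 - real n) * x * poly (U n (k + 1)) x
    + (real k + 1) * (real k - 2 * real n) * poly (U n k) x = 0"
proof -
  \<comment> \<open>\<open>E k\<close> is the left-hand side as a polynomial. The induction on
    \<open>k\<close> is then mere differentiation, since \<open>E (Suc k)\<close> is the derivative
    of \<open>E k\<close>.\<close>
  define E where "E k = [:- 1, 0, 1:] * U n (k + 2) + [:0, 2 * (real k + 1 - real n):] * U n (k + 1)
    + Polynomial.smult ((real k + 1) * (real k - 2 * real n)) (U n k)" for k
  have Suc: "pderiv (U n k) = U n (Suc k)" for k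
    by (simp add: U_def)
  define w :: "real poly" where "w = [:- 1, 0, 1:]"
  have w: "poly w x = x\<^sup>2 - 1" "poly (pderiv w) x = 2 * x" for x
    by (simp_all add: w_def pderiv_pCons power2_eq_square)
  \<comment> \<open>The first-order equation for (x^2 - 1)^n; its derivative is
    \<open>E 0 = 0\<close>.\<close>
  have "w * U n 1 = [:0, 2 * real n:] * U n 0"
  proof (cases n)
    case 0
    thus ?thesis by (simp add: U_def)
  next
    case (Suc m)
    have "U n 1 = pderiv (w ^ Suc m)"
      by (simp add: U_def w_def Suc)
    thus ?thesis
      unfolding pderiv_power_Suc
      by (simp add: U_def Suc w poly_eq_poly_eq_iff [symmetric] fun_eq_iff flip: w_def)
  qed
  hence "pderiv (w * U n 1) - pderiv ([:0, 2 * real n:] * U n 0) = 0"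
    by simp
  hence "E 0 = 0"
    unfolding pderiv_mult Suc E_def w_def
    by (simp add: pderiv_pCons poly_eq_poly_eq_iff [symmetric] fun_eq_iff numeral_2_eq_2 algebra_simps)
  moreover have "E (Suc k) = pderiv (E k)" for k
    unfolding E_def pderiv_add pderiv_mult pderiv_smult Suc
    by (simp add: pderiv_pCons poly_eq_poly_eq_iff [symmetric] fun_eq_iff algebra_simps)
  ultimately have "E k = 0" for k
    by (induction k) simp_all
  hence "poly (E k) x = 0"
    by simp
  thus ?thesis
    by (simp add: E_def power2_eq_square algebra_simps)
qed

text \<open>Rodrigues' formula makes \<open>D m\<close> a multiple of the derivative of order n + m
  of (x^2 - 1)^n, so this is \<open>rodrigues_ode\<close> at \<open>k = n + m\<close>. For
  \<open>m = 0\<close> it is Legendre's equation.\<close>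

lemma legendre_ode:
  fixes x :: real and n :: nat
  defines "D \<equiv> \<lambda>m. poly ((pderiv ^^ m) (legendre n)) x"
  shows "(x\<^sup>2 - 1) * D (m + 2) + 2 * (real m + 1) * x * D (m + 1)
    = (real n - real m) * (real n + real m + 1) * D m"
proof -
  have D: "D m = poly ((pderiv ^^ (n + m)) ([:- 1, 0, 1:] ^ n)) x / (2 ^ n * fact n)" for m
    by (simp add: D_def legendre_def higher_pderiv_smult funpow_add add.commute[of n])
  show ?thesis
    using rodrigues_ode[where n = n and k = "n + m" and x = x] unfolding D add.assoc[of n m]
    by (simp add: divide_simps) (simp add: algebra_simps)
qed

text \<open>Integration by parts. With D_m the m-th derivative of P_n, the equation above has the
  self-adjoint form ((1 - x^2)^(m+1) D_(m+1))' = -(n - m)(n + m + 1)(1 - x^2)^m D_m, and the factor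
  1 - x^2 kills the boundary terms.\<close>

lemma poly_integral_ladder:
  "poly_integral ([:1, 0, - 1:] ^ Suc m * (pderiv ^^ Suc m) (legendre n) * pderiv q)
   = (real n - real m) * (real n + real m + 1)
     * poly_integral ([:1, 0, - 1:] ^ m * (pderiv ^^ m) (legendre n) * q)"
proof -
  define D where "D m = (pderiv ^^ m) (legendre n)" for m
  define v :: "real poly" where "v = [:1, 0, - 1:]"
  have Suc: "pderiv (D m) = D (Suc m)" for m
    by (simp add: D_def)
  have "pderiv (v ^ Suc m * D (Suc m) * q) = v ^ Suc m * D (Suc m) * pderiv q
     - Polynomial.smult ((real n - real m) * (real n + real m + 1)) (v ^ m * D m * q)" (is "?l = ?r")
  proof (rule poly_eq_poly_eq_iff [THEN iffD1], rule ext)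
    fix x
    have ode: "(x\<^sup>2 - 1) * poly (D (Suc (Suc m))) x + 2 * (real m + 1) * x * poly (D (Suc m)) x
      = (real n - real m) * (real n + real m + 1) * poly (D m) x"
      using legendre_ode[of x m n] by (simp add: D_def)
    have v: "poly v x = 1 - x\<^sup>2" "poly (pderiv v) x = - 2 * x"
      by (simp_all add: v_def pderiv_pCons power2_eq_square)
    have "poly ?l x = poly v x ^ Suc m * poly (D (Suc m)) x * poly (pderiv q) x
      - poly v x ^ m * poly q x *
        ((x\<^sup>2 - 1) * poly (D (Suc (Suc m))) x + 2 * (real m + 1) * x * poly (D (Suc m)) x)"
      unfolding pderiv_mult pderiv_power_Suc Suc
      by (simp add: v) (simp add: algebra_simps)
    thus "poly ?l x = poly ?r x"
      unfolding ode by (simp add: algebra_simps)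
  qed
  hence "poly_integral (v ^ Suc m * D (Suc m) * pderiv q)
     - (real n - real m) * (real n + real m + 1) * poly_integral (v ^ m * D m * q)
     = poly_integral (pderiv (v ^ Suc m * D (Suc m) * q))"
    by (simp add: poly_integral_diff poly_integral_smult)
  also have "\<dots> = 0"
    unfolding poly_integral_pderiv by (simp add: v_def)
  finally show ?thesis
    by (simp add: v_def D_def)
qed

section \<open>Orthogonality to lower degrees\<close>

text \<open>Two integrations by parts move the Legendre operator from P_n to x^d. It multiplies P_n
  by -n(n+1) and sends x^d to -d(d+1) x^d plus a multiple of x^(d-2), which contributes nothing by
  induction; as n(n+1) and d(d+1) differ, the integral is zero.\<close>

lemma legendre_orthogonal_monom:
  "d < n \<Longrightarrow> poly_integral (legendre n * monom 1 d) = 0"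
proof (induction d rule: less_induct)
  case (less d)
  define P where "P = legendre n"
  define q :: "real poly" where "q = monom 1 d"
  define v :: "real poly" where "v = [:1, 0, - 1:]"
  have v: "poly v x = 1 - x\<^sup>2" "poly (pderiv v) x = - 2 * x" for x
    by (simp_all add: v_def pderiv_pCons power2_eq_square)
  \<comment> \<open>The lower-order term of ((1 - x^2) q')'; for \<open>d < 2\<close> there is
    none.\<close>
  define r where "r = (if d < 2 then 0
    else Polynomial.smult (real d * (real d - 1)) (monom 1 (d - 2)) :: real poly)"
  have int: "poly_integral (v * pderiv P * pderiv q) = real n * (real n + 1) * poly_integral (P * q)"
    using poly_integral_ladder[of 0 n q] by (simp add: P_def v_def)
  have r0: "poly_integral (P * r) = 0"
    using less.IH[of "d - 2"] less.prems
    by (simp add: r_def P_def poly_integral_smult)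
  have "pderiv (v * pderiv q) = r - Polynomial.smult (real d * (real d + 1)) q"
  proof -
    consider "d = 0" | "d = 1" | e where "d = Suc (Suc e)"
      by (metis One_nat_def not0_implies_Suc)
    thus ?thesis
      by cases (simp_all add: q_def v r_def pderiv_mult pderiv_monom poly_monom
          poly_eq_poly_eq_iff [symmetric] fun_eq_iff algebra_simps power2_eq_square)
  qed
  hence "pderiv (v * pderiv q * P) = v * pderiv q * pderiv P
      + (P * r - Polynomial.smult (real d * (real d + 1)) (P * q))"
    by (simp add: pderiv_mult[of _ P] right_diff_distrib)
  moreover have "poly_integral (pderiv (v * pderiv q * P)) = 0"
    unfolding poly_integral_pderiv by (simp add: v_def)
  ultimately have "poly_integral (v * pderiv q * pderiv P)
      + poly_integral (P * r) - real d * (real d + 1) * poly_integral (P * q) = 0"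
    by (simp add: poly_integral_add poly_integral_diff poly_integral_smult)
  hence "(real n * (real n + 1) - real d * (real d + 1)) * poly_integral (P * q) = 0"
    using int r0 by (auto simp: mult_ac left_diff_distrib)
  moreover have "real d * (real d + 1) < real n * (real n + 1)"
    using less.prems by (intro mult_strict_mono) auto
  ultimately show ?case
    by (simp add: P_def q_def)
qed

lemma legendre_orthogonal:
  assumes "degree q < n \<or> q = 0"
  shows "poly_integral (legendre n * q) = 0"
proof (cases "q = 0")
  case False
  have "legendre n * q = legendre n * (\<Sum>i\<le>degree q. monom (Polynomial.coeff q i) i)"
    by (simp add: poly_as_sum_of_monoms)
  also have "\<dots> = (\<Sum>i\<le>degree q. Polynomial.smult (Polynomial.coeff q i) (legendre n * monom 1 i))"
    by (simp add: sum_distrib_left smult_monom flip: mult_smult_right)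
  finally show ?thesis
    using assms False
    by (simp add: poly_integral_sum poly_integral_smult legendre_orthogonal_monom)
qed simp

section \<open>Degrees and norms of Legendre polynomials\<close>

lemma degree_legendre: "degree (legendre n) = n"
  by (simp add: legendre_def degree_higher_pderiv degree_power_eq)

text \<open>Up to the Rodrigues factor this is the derivative of order 2n of (x^2 - 1)^n, which is
  monic of degree 2n.\<close>

lemma higher_pderiv_legendre:
  "(pderiv ^^ n) (legendre n) = [:fact (2 * n) / (2 ^ n * fact n):]"
proof -
  define p where "p = (pderiv ^^ (2 * n)) ([:- 1, 0, 1:] ^ n :: real poly)"
  have "Polynomial.coeff ([:- 1, 0, 1:] ^ n :: real poly) (2 * n) = 1"
    using lead_coeff_power[of "[:- 1, 0, 1:] :: real poly" n]
    by (simp add: degree_power_eq mult_2)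
  hence "Polynomial.coeff p 0 = fact (2 * n)"
    by (simp add: p_def coeff_higher_pderiv pochhammer_fact)
  moreover have "degree p = 0"
    by (simp add: p_def degree_higher_pderiv degree_power_eq)
  ultimately have "p = [:fact (2 * n):]"
    by (metis degree_eq_zeroE coeff_pCons_0)
  moreover have "(pderiv ^^ n) (legendre n) = Polynomial.smult (1 / (2 ^ n * fact n)) p"
    by (simp add: legendre_def p_def higher_pderiv_smult mult_2 funpow_add)
  ultimately show ?thesis
    by simp
qed

text \<open>A Beta integral, found by recursion: x (1 - x^2)^(n+1) vanishes at both ends, and its
  derivative links the exponents n + 1 and n.\<close>

lemma poly_integral_one_minus_square_power:
  "poly_integral ([:1, 0, - 1:] ^ n) = 2 * 4 ^ n * (fact n)\<^sup>2 / fact (2 * n + 1)"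
proof (induction n)
  case 0
  show ?case
    using poly_integral_pderiv[of "[:0, 1:]"] by (simp add: pderiv_pCons one_pCons)
next
  case (Suc n)
  define v :: "real poly" where "v = [:1, 0, - 1:]"
  have "pderiv ([:0, 1:] * v ^ Suc n) = Polynomial.smult (2 * real n + 3) (v ^ Suc n)
    - Polynomial.smult (2 * real n + 2) (v ^ n)"
    unfolding pderiv_mult pderiv_power_Suc
    by (simp add: v_def pderiv_pCons poly_eq_poly_eq_iff [symmetric] fun_eq_iff algebra_simps)
  hence "(2 * real n + 3) * poly_integral (v ^ Suc n) - (2 * real n + 2) * poly_integral (v ^ n)
    = poly_integral (pderiv ([:0, 1:] * v ^ Suc n))"
    by (simp only: poly_integral_diff poly_integral_smult)
  also have "\<dots> = 0"
    unfolding poly_integral_pderiv by (simp add: v_def)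
  finally have "poly_integral (v ^ Suc n) = (2 * real n + 2) / (2 * real n + 3) * poly_integral (v ^ n)"
    by (simp add: field_simps)
  also have "\<dots> = 2 * 4 ^ Suc n * (fact (Suc n))\<^sup>2 / fact (2 * Suc n + 1)"
  proof -
    have "fact (2 * Suc n + 1) = (2 * real n + 2) * (2 * real n + 3) * fact (2 * n + 1)"
      by (simp add: algebra_simps)
    moreover have "fact (Suc n) = (real n + 1) * fact n"
      by simp
    ultimately show ?thesis
      unfolding v_def Suc.IH by (simp only:) (simp add: divide_simps power2_eq_square, simp add: algebra_simps)
  qed
  finally show ?case
    by (simp add: v_def)
qed

text \<open>Going down \<open>m\<close> rungs of the ladder collects the factors (n - i)(n + i + 1)
  for i < m, whose product is the quotient of factorials.\<close>

lemma poly_integral_higher_pderiv_legendre: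
  assumes "m \<le> n"
  shows "poly_integral ([:1, 0, - 1:] ^ m * (pderiv ^^ m) (legendre n) * (pderiv ^^ m) q)
    = fact (n + m) / fact (n - m) * poly_integral (legendre n * q)"
  using assms
proof (induction m)
  case (Suc m)
  have "(real n - real m) * (real n + real m + 1) * (fact (n + m) / fact (n - m))
    = (fact (n + Suc m) / fact (n - Suc m) :: real)"
    using Suc.prems by (simp add: Suc_diff_Suc [symmetric] field_simps)
  moreover have "poly_integral ([:1, 0, - 1:] ^ Suc m * (pderiv ^^ Suc m) (legendre n) * (pderiv ^^ Suc m) q)
    = (real n - real m) * (real n + real m + 1)
      * (fact (n + m) / fact (n - m) * poly_integral (legendre n * q))"
    using Suc poly_integral_ladder[of m n "(pderiv ^^ m) q"] by simp
  ultimately show ?case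
    by (metis mult.assoc)
qed simp

text \<open>At the rung \<open>m = n\<close> both derivatives equal the constant \<open>c\<close>,
  so only the Beta integral remains.\<close>

lemma poly_integral_legendre_square: "poly_integral (legendre n * legendre n) = 2 / (2 * real n + 1)"
proof -
  define c :: real where "c = fact (2 * n) / (2 ^ n * fact n)"
  have "[:1, 0, - 1:] ^ n * (pderiv ^^ n) (legendre n) * (pderiv ^^ n) (legendre n)
    = Polynomial.smult (c * c) ([:1, 0, - 1:] ^ n)"
    unfolding higher_pderiv_legendre c_def by simp
  hence "fact (2 * n) * poly_integral (legendre n * legendre n)
    = c * c * (2 * 4 ^ n * (fact n)\<^sup>2 / fact (2 * n + 1))"
    using poly_integral_higher_pderiv_legendre[of n n "legendre n"]
    by (simp add: poly_integral_smult poly_integral_one_minus_square_power flip: mult_2)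
  also have "\<dots> = fact (2 * n) * (2 / (2 * real n + 1))"
    by (simp add: c_def divide_simps power2_eq_square flip: power_mult_distrib)
  finally show ?thesis
    using mult_left_cancel[OF fact_nonzero] by blast
qed

lemma poly_integral_legendre_legendre:
  "poly_integral (legendre n * legendre l) = (if n = l then 2 / (2 * real n + 1) else 0)"
  using legendre_orthogonal[of "legendre n" l] legendre_orthogonal[of "legendre l" n]
  by (cases n l rule: linorder_cases)
    (simp_all add: poly_integral_legendre_square degree_legendre mult.commute)

section \<open>Exactness of the quadrature rules\<close>

text \<open>A geometric sum of a (2N+1)-th root of unity \<open>z\<close>. Since 0 < |d| < 2N + 1,
  the integer \<open>d\<close> is no multiple of 2N + 1, so \<open>z\<close> is not 1.\<close>

lemma sum_exp_equidistant:
  fixes d :: int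
  assumes "d \<noteq> 0" "\<bar>d\<bar> \<le> 2 * int N"
  shows "(\<Sum>j=0..2 * N. exp (\<i> * of_int d * of_real (2 * pi * real j / (2 * real N + 1)))) = 0"
proof -
  define z where "z = exp (\<i> * of_int d * of_real (2 * pi / (2 * real N + 1)))"
  have pow: "z ^ j = exp (\<i> * of_int d * of_real (2 * pi * real j / (2 * real N + 1)))" for j
    by (simp add: z_def flip: exp_of_nat_mult) (simp add: mult_ac)
  have "z ^ Suc (2 * N) = exp (\<i> * of_int d * of_real (2 * pi))"
    unfolding pow by (simp add: add.commute)
  also have "\<dots> = 1"
    by (simp add: exp_eq_1)
  finally have "z ^ Suc (2 * N) = 1" .
  moreover have "z \<noteq> 1"
  proof
    assume "z = 1"
    then obtain n :: int where "real_of_int d * (2 * pi / (2 * real N + 1)) = of_int (2 * n) * pi"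
      by (auto simp: z_def exp_eq_1)
    hence "2 * pi * real_of_int d = 2 * pi * of_int (n * (2 * int N + 1))"
      by (simp add: field_simps)
    hence "real_of_int d = of_int (n * (2 * int N + 1))"
      by simp
    hence d: "d = n * (2 * int N + 1)"
      by linarith
    hence "n \<noteq> 0"
      using assms(1) by auto
    hence "2 * int N + 1 \<le> \<bar>d\<bar>"
      unfolding d abs_mult using mult_right_mono[of 1 "\<bar>n\<bar>" "2 * int N + 1"] by simp
    with assms(2) show False
      by simp
  qed
  ultimately have "(\<Sum>j<Suc (2 * N). z ^ j) = 0"
    by (subst geometric_sum) simp_all
  thus ?thesis
    unfolding pow by (simp add: atLeast0AtMost lessThan_Suc_atMost)
qed

section \<open>Gauss quadrature at the roots of \<open>legendre N\<close>\<close>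

text \<open>The bijection says both that there are exactly \<open>N\<close> real roots and that
  \<open>lam\<close> lists each of them once.\<close>

locale legendre_nodes =
  fixes N :: nat and lam :: "nat \<Rightarrow> real"
  assumes bij_nodes: "bij_betw lam {1..N} {x. poly (legendre N) x = 0}"
begin

lemma node_root: "k \<in> {1..N} \<Longrightarrow> poly (legendre N) (lam k) = 0"
  using bij_nodes by (auto simp: bij_betw_def)

lemma inj_nodes: "inj_on lam {1..N}"
  using bij_nodes by (simp add: bij_betw_def)

lemma lagrange_fund:
  assumes "k \<in> {1..N}"
  shows degree_lagrange_fund: "degree (lagrange_fund N lam k) = N - 1"
    and poly_lagrange_fund:
      "i \<in> {1..N} \<Longrightarrow> poly (lagrange_fund N lam k) (lam i) = (if i = k then 1 else 0)"
  using theI'[OF lagrange_fund_ex1[OF inj_nodes assms]] unfolding lagrange_fund_def [symmetric]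
  by blast+

lemma christoffel_eq: "christoffel N lam k = poly_integral (lagrange_fund N lam k)"
  by (simp add: christoffel_def poly_integral_def)

text \<open>
  The error of interpolation at the roots of \<open>legendre N\<close> is a multiple
  \<open>legendre N * q\<close>, where \<open>degree q < N\<close>, and this integrates to zero.
\<close>

lemma gauss_quadrature:
  assumes "degree p < 2 * N"
  shows "poly_integral p = (\<Sum>k=1..N. christoffel N lam k * poly p (lam k))"
proof -
  define P where "P = legendre N"
  have P: "degree P = N" and N: "N \<ge> 1"
    using assms by (simp_all add: P_def degree_legendre)
  hence P0: "P \<noteq> 0"
    by auto
  define q r where "q = p div P" and "r = p mod P"
  have p: "p = P * q + r"
    by (simp add: q_def r_def)
  have r: "degree r < N"
    unfolding r_def using degree_mod_less[OF P0, of p] P N by auto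
  have q: "degree q < N \<or> q = 0"
  proof (rule ccontr)
    assume "\<not> (degree q < N \<or> q = 0)"
    hence "degree (P * q) \<ge> 2 * N"
      using P P0 by (simp add: degree_mult_eq)
    hence "degree p \<ge> 2 * N"
      using r by (subst p) (simp add: degree_add_eq_left)
    thus False
      using assms by simp
  qed
  have r_node: "poly r (lam k) = poly p (lam k)" if "k \<in> {1..N}" for k
    using node_root[OF that] by (simp add: p P_def)
  \<comment> \<open>Lagrange interpolation reproduces the remainder: both sides have degree below
    \<open>N\<close> and agree at \<open>N\<close> distinct nodes.\<close>
  have "r = (\<Sum>k=1..N. Polynomial.smult (poly p (lam k)) (lagrange_fund N lam k))" (is "_ = ?s")
  proof (rule poly_eqI_degree[where A = "lam ` {1..N}"])
    fix x assume "x \<in> lam ` {1..N}"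
    then obtain i where i: "i \<in> {1..N}" "x = lam i"
      by blast
    hence "poly ?s x = (\<Sum>k=1..N. if i = k then poly p (lam k) else 0)"
      unfolding poly_sum i(2) by (intro sum.cong refl) (simp add: poly_lagrange_fund)
    thus "poly r x = poly ?s x"
      using i by (simp add: r_node)
  next
    have "degree ?s \<le> N - 1"
      by (intro degree_sum_le) (auto simp: degree_lagrange_fund intro: order_trans[OF degree_smult_le])
    thus "degree r < card (lam ` {1..N})" "degree ?s < card (lam ` {1..N})"
      using r N card_image[OF inj_nodes] by simp_all
  qed
  hence "poly_integral r = (\<Sum>k=1..N. christoffel N lam k * poly p (lam k))"
    by (simp add: poly_integral_sum poly_integral_smult christoffel_eq mult.commute)
  moreover have "poly_integral (P * q) = 0"
    unfolding P_def by (rule legendre_orthogonal[OF q])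
  ultimately show ?thesis
    by (subst p) (simp add: poly_integral_add)
qed

text \<open>Quadrature is exact on the square of the fundamental polynomial, of degree 2N - 2, and
  sees only its value 1 at node \<open>k\<close>. The weight is thus the integral of a
  square.\<close>

lemma christoffel_nonneg:
  assumes "k \<in> {1..N}"
  shows "0 \<le> christoffel N lam k"
proof -
  define l where "l = lagrange_fund N lam k"
  have "degree (l * l) \<le> (N - 1) + (N - 1)"
    using degree_mult_le[of l l] assms by (simp add: l_def degree_lagrange_fund)
  hence "poly_integral (l * l) = (\<Sum>i=1..N. christoffel N lam i * poly (l * l) (lam i))"
    using assms by (intro gauss_quadrature) auto
  also have "\<dots> = (\<Sum>i=1..N. if i = k then christoffel N lam i else 0)"
    using assms by (intro sum.cong refl) (simp add: l_def poly_lagrange_fund)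
  also have "\<dots> = christoffel N lam k"
    using assms by simp
  finally have "christoffel N lam k = poly_integral (l * l)"
    by simp
  also have "\<dots> \<ge> 0"
    unfolding poly_integral_def by (intro integral_nonneg poly_integrable) simp
  finally show ?thesis .
qed

text \<open>
  A root \<open>y\<close> outside the open interval would give \<open>legendre N = (x - y) q\<close>, where
  \<open>(x - y) q\<^sup>2\<close> does not change its sign although it has integral zero.
\<close>

lemma node_bounds:
  assumes "k \<in> {1..N}"
  shows "\<bar>lam k\<bar> < 1"
proof (rule ccontr)
  assume "\<not> \<bar>lam k\<bar> < 1"
  hence "1 * lam k \<ge> 1 \<or> - 1 * lam k \<ge> 1"
    by linarith
  \<comment> \<open>The sign \<open>s\<close> treats roots on either side of the interval together:
    s (lam k - x) is nonnegative for x in [-1, 1].\<close>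
  then obtain s :: real where s: "s = 1 \<or> s = - 1" "s * lam k \<ge> 1"
    by blast
  obtain q where q: "legendre N = [:- lam k, 1:] * q"
    using node_root[OF assms] by (auto simp: poly_eq_0_iff_dvd)
  have "q \<noteq> 0"
    using q assms degree_legendre[of N] by auto
  hence deg: "degree q < N"
    using degree_mult_eq[of "[:- lam k, 1:]" q] q degree_legendre[of N] by simp
  have "0 \<le> poly ([:s * lam k, - s:] * (q * q)) x" if "x \<in> {- 1..1}" for x
  proof -
    have "s * x \<le> 1"
      using s(1) that by auto
    hence "0 \<le> (s * lam k - s * x) * (poly q x * poly q x)"
      using s(2) by (intro mult_nonneg_nonneg[OF _ zero_le_square]) simp
    thus ?thesis
      by (simp add: algebra_simps)
  qed
  moreover have "[:s * lam k, - s:] * (q * q) \<noteq> 0"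
    using \<open>q \<noteq> 0\<close> s(1) by (simp only: mult_eq_0_iff) auto
  ultimately have "0 < poly_integral ([:s * lam k, - s:] * (q * q))"
    by (rule poly_integral_pos)
  also have "[:s * lam k, - s:] * (q * q) = Polynomial.smult (- s) (legendre N * q)"
    by (simp add: q poly_eq_poly_eq_iff [symmetric] fun_eq_iff algebra_simps)
  finally show False
    using legendre_orthogonal[of q N] deg unfolding poly_integral_smult by simp
qed

section \<open>Discrete orthonormality of the spherical functions\<close>

text \<open>For equal orders the square-root factors combine to (1 - x^2)^m, so the product is a
  polynomial. Quadrature integrates it exactly, and the ladder reduces the integral to order
  0.\<close>

lemma assoc_legendre_orthogonal:
  assumes "n < N" "l < N" "m \<le> n" "m \<le> l"
  shows "(\<Sum>k=1..N. christoffel N lam k * (assoc_legendre n m (lam k) * assoc_legendre l m (lam k)))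
    = (if n = l then 2 / (2 * real n + 1) else 0)"
proof -
  define c where "c n = (fact (n - m) / fact (n + m) :: real)" for n
  define D where "D n = (pderiv ^^ m) (legendre n)" for n
  define p where "p = [:1, 0, - 1:] ^ m * D n * D l"
  have c: "c n > 0" "c l > 0"
    by (simp_all add: c_def)
  have val: "assoc_legendre n m (lam k) * assoc_legendre l m (lam k)
      = sqrt (c n) * sqrt (c l) * poly p (lam k)" if "k \<in> {1..N}" for k
  proof -
    have "(lam k)\<^sup>2 \<le> 1"
      using node_bounds[OF that] by (simp add: abs_square_le_1)
    hence "sqrt (1 - (lam k)\<^sup>2) ^ m * sqrt (1 - (lam k)\<^sup>2) ^ m = (1 - (lam k)\<^sup>2) ^ m"
      by (simp flip: power_mult_distrib)
    moreover have "poly p (lam k) = (1 - (lam k)\<^sup>2) ^ m * poly (D n) (lam k) * poly (D l) (lam k)"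
      by (simp add: p_def power2_eq_square)
    ultimately show ?thesis
      by (simp add: assoc_legendre_def c_def D_def)
  qed
  \<comment> \<open>As m \<le> n and m \<le> l, this bound is n + l \<le> 2N - 2, within the range
    of exactness.\<close>
  have "degree p \<le> 2 * m + (n - m) + (l - m)"
    using degree_mult_le[of "[:1, 0, - 1:] ^ m * D n" "D l"]
      degree_mult_le[of "[:1, 0, - 1:] ^ m" "D n"]
    by (simp add: p_def D_def degree_higher_pderiv degree_legendre degree_power_eq)
  hence deg: "degree p < 2 * N"
    using assms by linarith
  have "(\<Sum>k=1..N. christoffel N lam k * (assoc_legendre n m (lam k) * assoc_legendre l m (lam k)))
      = (\<Sum>k=1..N. sqrt (c n) * sqrt (c l) * (christoffel N lam k * poly p (lam k)))"
    by (intro sum.cong refl) (simp add: val)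
  also have "\<dots> = sqrt (c n) * sqrt (c l) * poly_integral p"
    by (simp add: gauss_quadrature[OF deg] sum_distrib_left)
  also have "poly_integral p = (1 / c n) * poly_integral (legendre n * legendre l)"
    using poly_integral_higher_pderiv_legendre[OF \<open>m \<le> n\<close>, of "legendre l"]
    by (simp add: p_def D_def c_def)
  also have "sqrt (c n) * sqrt (c l) * (1 / c n * poly_integral (legendre n * legendre l))
      = (if n = l then 2 / (2 * real n + 1) else 0)"
    using c by (simp add: poly_integral_legendre_legendre)
  finally show ?thesis .
qed

text \<open>The product is a function of \<theta> times exp(i (k' - k) \<phi>), so the double sum
  factors into a Gauss sum and an equidistant sum.\<close>

lemma sphY_discrete_orthonormal:
  assumes "(n, k) \<in> col_indices N" "(l, k') \<in> col_indices N"
  shows "discrete_integral N lam (\<lambda>\<eta>. cnj (sphY n k \<eta>) * sphY l k' \<eta>)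
    = (if n = l \<and> k = k' then 1 else 0)"
proof -
  have nl: "n < N" "l < N" and kk: "\<bar>k\<bar> \<le> int n" "\<bar>k'\<bar> \<le> int l"
    using assms by (auto simp: col_indices_def)
  define a where "a i = assoc_legendre n (nat \<bar>k\<bar>) (lam i) * assoc_legendre l (nat \<bar>k'\<bar>) (lam i)" for i
  \<comment> \<open>\<open>s\<close> gathers both normalizations and the denominator of the weights;
    for equal indices it cancels 2 / (2n + 1) and the number 2N + 1 of longitudes.\<close>
  define s where "s = sqrt (2 * real n + 1) * sqrt (2 * real l + 1) / (2 * (2 * real N + 1))"
  define e where "e j = exp (\<i> * of_int (k' - k) * of_real (2 * pi * real j / (2 * real N + 1)))" for j
  have "discrete_integral N lam (\<lambda>\<eta>. cnj (sphY n k \<eta>) * sphY l k' \<eta>)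
    = (\<Sum>i=1..N. \<Sum>j=0..2 * N. complex_of_real (s * (christoffel N lam i * a i)) * e j)"
    unfolding discrete_integral_def
  proof (intro sum.cong refl)
    fix i j assume i: "i \<in> {1..N}"
    define x where "x = 2 * pi * real j / (2 * real N + 1)"
    have "cos (arccos (lam i)) = lam i"
      using node_bounds[OF i] by (intro cos_arccos_abs) simp
    hence Y: "sphY n k (node N lam (i, j)) = of_real (sqrt (2 * real n + 1) * assoc_legendre n (nat \<bar>k\<bar>) (lam i))
        * exp (\<i> * of_int k * of_real x)" for n k
      by (simp only: sphY_def node_def case_prod_conv x_def)
    have exps: "cnj (exp (\<i> * of_int k * of_real x)) * exp (\<i> * of_int k' * of_real x) = e j"
      unfolding e_def x_def [symmetric] exp_cnj exp_add [symmetric]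
      by (rule arg_cong[of _ _ exp]) (simp add: algebra_simps)
    have "cnj (of_real b * z) * (of_real c * z') * of_real w = of_real (b * c * w) * (cnj z * z')"
      for b c w and z z' :: complex
      by simp
    hence "cnj (sphY n k (node N lam (i, j))) * sphY l k' (node N lam (i, j)) * complex_of_real (weight N lam (i, j))
        = of_real (sqrt (2 * real n + 1) * assoc_legendre n (nat \<bar>k\<bar>) (lam i)
          * (sqrt (2 * real l + 1) * assoc_legendre l (nat \<bar>k'\<bar>) (lam i)) * weight N lam (i, j)) * e j"
      unfolding Y exps [symmetric] by blast
    also have "sqrt (2 * real n + 1) * assoc_legendre n (nat \<bar>k\<bar>) (lam i)
          * (sqrt (2 * real l + 1) * assoc_legendre l (nat \<bar>k'\<bar>) (lam i)) * weight N lam (i, j)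
        = s * (christoffel N lam i * a i)"
      by (simp add: weight_def s_def a_def)
    finally show "cnj (sphY n k (node N lam (i, j))) * sphY l k' (node N lam (i, j))
        * complex_of_real (weight N lam (i, j)) = complex_of_real (s * (christoffel N lam i * a i)) * e j" .
  qed
  also have "\<dots> = complex_of_real (s * (\<Sum>i=1..N. christoffel N lam i * a i)) * (\<Sum>j=0..2 * N. e j)"
    unfolding sum_product [symmetric] sum_distrib_left of_real_sum by (rule refl)
  also have "\<dots> = (if n = l \<and> k = k' then 1 else 0)"
  proof (cases "k = k'")
    case True
    have "(\<Sum>i=1..N. christoffel N lam i * a i) = (if n = l then 2 / (2 * real n + 1) else 0)"
      unfolding a_def True using nl kk True by (intro assoc_legendre_orthogonal) auto
    moreover have "(\<Sum>j=0..2 * N. e j) = complex_of_real (2 * real N + 1)"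
      by (simp add: e_def True)
    ultimately show ?thesis
      using True
      by (simp add: s_def flip: of_real_mult of_real_add of_real_divide) (simp add: algebra_simps)
  next
    case False
    \<comment> \<open>Both orders are less than \<open>N\<close> in absolute value, so their
      difference stays within the bound 2N.\<close>
    hence "(\<Sum>j=0..2 * N. e j) = 0"
      unfolding e_def using nl kk by (intro sum_exp_equidistant) auto
    with False show ?thesis
      by simp
  qed
  finally show ?thesis .
qed

end

section \<open>Least squares with orthonormal columns\<close>

lemma index_mat_adjoint:
  fixes A :: "complex mat"
  assumes "A \<in> carrier_mat m n" "i < n" "j < m"
  shows "mat_adjoint A $$ (i, j) = cnj (A $$ (j, i))"
  using assms by (auto simp: mat_adjoint_def mat_of_rows_index)

lemma mat_adjoint_carrier:
  fixes A :: "complex mat"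
  shows "A \<in> carrier_mat m n \<Longrightarrow> mat_adjoint A \<in> carrier_mat n m"
  by (auto simp: mat_adjoint_def)

lemma index_mult_mat_vec_sum:
  assumes "A \<in> carrier_mat m n" "v \<in> carrier_vec n" "i < m"
  shows "(A *\<^sub>v v) $ i = (\<Sum>j<n. A $$ (i, j) * v $ j)"
  using assms by (auto simp: scalar_prod_def atLeast0LessThan)

lemma norm2_square: "v \<in> carrier_vec n \<Longrightarrow> (norm2 v)\<^sup>2 = (\<Sum>i<n. (cmod (v $ i))\<^sup>2)"
  by (auto simp: norm2_def L2_set_def intro!: real_sqrt_pow2 sum_nonneg)

lemma norm2_nonneg: "0 \<le> norm2 v"
  by (simp add: norm2_def)

text \<open>The adjoint moves \<open>A\<close> across the inner product. This serves twice: for the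
  vanishing cross term and for the isometry.\<close>

lemma sum_mult_mat_vec_cnj:
  assumes A: "A \<in> carrier_mat m n" and v: "v \<in> carrier_vec n" and u: "u \<in> carrier_vec m"
  shows "(\<Sum>i<m. (A *\<^sub>v v) $ i * cnj (u $ i)) = (\<Sum>j<n. v $ j * cnj ((mat_adjoint A *\<^sub>v u) $ j))"
proof -
  have "(\<Sum>i<m. (A *\<^sub>v v) $ i * cnj (u $ i)) = (\<Sum>i<m. \<Sum>j<n. v $ j * cnj (cnj (A $$ (i, j)) * u $ i))"
    by (simp add: index_mult_mat_vec_sum[OF A v] sum_distrib_left sum_distrib_right mult_ac
        del: index_mult_mat_vec)
  also have "\<dots> = (\<Sum>j<n. v $ j * cnj ((mat_adjoint A *\<^sub>v u) $ j))"
    by (subst sum.swap)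
      (simp add: index_mult_mat_vec_sum[OF mat_adjoint_carrier[OF A] u] index_mat_adjoint[OF A]
        sum_distrib_left del: index_mult_mat_vec)
  finally show ?thesis .
qed

lemma norm2_square_add:
  assumes "u \<in> carrier_vec n" "v \<in> carrier_vec n"
  shows "(norm2 (u + v))\<^sup>2 = (norm2 u)\<^sup>2 + (norm2 v)\<^sup>2 + 2 * Re (\<Sum>i<n. v $ i * cnj (u $ i))"
proof -
  have "(cmod (x + y))\<^sup>2 = (cmod x)\<^sup>2 + (cmod y)\<^sup>2 + 2 * Re (y * cnj x)" for x y
    unfolding cmod_power2 by (simp add: power2_eq_square algebra_simps)
  thus ?thesis
    using assms by (simp add: norm2_square[of _ n] sum.distrib sum_distrib_left)
qed

text \<open>Pythagoras for g - A b = (g - A a) + A (a - b): the first summand is orthogonal to the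
  range of \<open>A\<close>, and \<open>A\<close> preserves norms because its columns are
  orthonormal.\<close>

lemma norm2_square_residual:
  assumes A: "A \<in> carrier_mat m n" and orth: "mat_adjoint A * A = 1\<^sub>m n"
    and g: "g \<in> carrier_vec m" and b: "b \<in> carrier_vec n"
  defines "a \<equiv> mat_adjoint A *\<^sub>v g"
  shows "(norm2 (g - A *\<^sub>v b))\<^sup>2 = (norm2 (g - A *\<^sub>v a))\<^sup>2 + (norm2 (a - b))\<^sup>2"
proof -
  note adj = mat_adjoint_carrier[OF A]
  have a: "a \<in> carrier_vec n"
    unfolding a_def using adj g by simp
  have left_inverse: "mat_adjoint A *\<^sub>v (A *\<^sub>v x) = x" if "x \<in> carrier_vec n" for x
    using that orth assoc_mult_mat_vec[OF adj A that] by simp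
  define d where "d = a - b"
  define h where "h = g - A *\<^sub>v a"
  have d: "d \<in> carrier_vec n" and h: "h \<in> carrier_vec m"
    using A a b g by (simp_all add: d_def h_def)
  \<comment> \<open>The normal equations: the adjoint sends the residual \<open>h\<close> to a -
    a.\<close>
  have "mat_adjoint A *\<^sub>v h = mat_adjoint A *\<^sub>v g - mat_adjoint A *\<^sub>v (A *\<^sub>v a)"
    unfolding h_def using mult_mat_vec_carrier[OF A a] by (rule mult_minus_distrib_mat_vec[OF adj g])
  hence "mat_adjoint A *\<^sub>v h = 0\<^sub>v n"
    unfolding left_inverse[OF a] using a by (simp add: a_def [symmetric])
  hence cross: "(\<Sum>i<m. (A *\<^sub>v d) $ i * cnj (h $ i)) = 0"
    unfolding sum_mult_mat_vec_cnj[OF A d h] by simp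
  have "A *\<^sub>v d = A *\<^sub>v a - A *\<^sub>v b"
    unfolding d_def by (rule mult_minus_distrib_mat_vec[OF A a b])
  hence split: "g - A *\<^sub>v b = h + A *\<^sub>v d"
    using A g by (intro eq_vecI) (auto simp: h_def)
  have "(\<Sum>i<m. (A *\<^sub>v d) $ i * cnj ((A *\<^sub>v d) $ i)) = (\<Sum>i<n. d $ i * cnj (d $ i))"
    unfolding sum_mult_mat_vec_cnj[OF A d mult_mat_vec_carrier[OF A d]] left_inverse[OF d] ..
  hence "complex_of_real (\<Sum>i<m. (cmod ((A *\<^sub>v d) $ i))\<^sup>2) = complex_of_real (\<Sum>i<n. (cmod (d $ i))\<^sup>2)"
    by (simp only: of_real_sum complex_norm_square)
  hence isometry: "(norm2 (A *\<^sub>v d))\<^sup>2 = (norm2 d)\<^sup>2"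
    using norm2_square[OF mult_mat_vec_carrier[OF A d]] norm2_square[OF d] by (simp only: of_real_eq_iff)
  show ?thesis
    unfolding split norm2_square_add[OF h mult_mat_vec_carrier[OF A d]] cross isometry
    by (simp add: h_def d_def)
qed

text \<open>The squared residual at \<open>b\<close> exceeds the one at the claimed solution by the
  squared distance between the two vectors, which gives minimality and uniqueness at once.\<close>

lemma is_arg_min_least_squares_iff:
  assumes A: "A \<in> carrier_mat m n" and orth: "mat_adjoint A * A = 1\<^sub>m n" and g: "g \<in> carrier_vec m"
  shows "is_arg_min (\<lambda>b. norm2 (g - A *\<^sub>v b)) (\<lambda>b. b \<in> carrier_vec n) a
    \<longleftrightarrow> a = mat_adjoint A *\<^sub>v g"
proof -
  define a0 where "a0 = mat_adjoint A *\<^sub>v g"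
  have a0: "a0 \<in> carrier_vec n"
    unfolding a0_def using mat_adjoint_carrier[OF A] g by simp
  note residual = norm2_square_residual[OF A orth g, folded a0_def]
  have le: "norm2 (g - A *\<^sub>v a0) \<le> norm2 (g - A *\<^sub>v b)" if "b \<in> carrier_vec n" for b
  proof (rule power2_le_imp_le[OF _ norm2_nonneg])
    show "(norm2 (g - A *\<^sub>v a0))\<^sup>2 \<le> (norm2 (g - A *\<^sub>v b))\<^sup>2"
      using residual[OF that] by simp
  qed
  have unique: "b = a0" if "b \<in> carrier_vec n" "norm2 (g - A *\<^sub>v b) \<le> norm2 (g - A *\<^sub>v a0)" for b
  proof -
    have "norm2 (g - A *\<^sub>v b) = norm2 (g - A *\<^sub>v a0)"
      using le that by (simp add: order_antisym)
    hence "(norm2 (a0 - b))\<^sup>2 = 0"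
      using residual[OF that(1)] by simp
    hence "\<forall>i<n. cmod ((a0 - b) $ i) = 0"
      using a0 that(1) by (simp add: norm2_square[of _ n] sum_nonneg_eq_0_iff del: index_minus_vec)
    thus "b = a0"
      using a0 that(1) by (intro eq_vecI) auto
  qed
  show ?thesis
    unfolding is_arg_min_linorder a0_def [symmetric]
  proof
    assume *: "a \<in> carrier_vec n \<and> (\<forall>b. b \<in> carrier_vec n \<longrightarrow> norm2 (g - A *\<^sub>v a) \<le> norm2 (g - A *\<^sub>v b))"
    show "a = a0"
      by (rule unique) (use * a0 in simp_all)
  next
    assume "a = a0"
    thus "a \<in> carrier_vec n \<and> (\<forall>b. b \<in> carrier_vec n \<longrightarrow> norm2 (g - A *\<^sub>v a) \<le> norm2 (g - A *\<^sub>v b))"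
      using a0 le by simp
  qed
qed

section \<open>The discrete integral over enumerated nodes\<close>

text \<open>Bridge from matrix products, which sum over row numbers, to the discrete integral, for
  any enumeration \<open>\<rho>\<close>.\<close>

lemma discrete_integral_enum:
  assumes "bij_betw \<rho> {..<N * (2 * N + 1)} (row_indices N)"
  shows "discrete_integral N lam F
    = (\<Sum>r<N * (2 * N + 1). F (node N lam (\<rho> r)) * complex_of_real (weight N lam (\<rho> r)))"
  using sum.reindex_bij_betw[OF assms, of "\<lambda>x. F (node N lam x) * complex_of_real (weight N lam x)"]
  by (simp add: discrete_integral_def row_indices_def sum.cartesian_product)

lemma discrete_integral_cmult: "discrete_integral N lam (\<lambda>\<eta>. c * F \<eta>) = c * discrete_integral N lam F"
  by (simp add: discrete_integral_def sum_distrib_left mult.assoc)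

lemma discrete_integral_sum:
  "discrete_integral N lam (\<lambda>\<eta>. \<Sum>i\<in>A. F i \<eta>) = (\<Sum>i\<in>A. discrete_integral N lam (F i))"
  by (induction A rule: infinite_finite_induct)
    (simp_all add: discrete_integral_def sum.distrib distrib_right)

section \<open>From matrix entries to discrete integrals\<close>

theorem mainTheorem1:
  fixes N :: nat
    and f :: "real ^ 3 \<Rightarrow> complex"
    and lam :: "nat \<Rightarrow> real"
    and \<rho> :: "nat \<Rightarrow> nat \<times> nat"
    and \<kappa> :: "nat \<Rightarrow> nat \<times> int"
    and \<Phi> I\<^sub>N \<Phi>\<^sub>1 :: "complex mat"
    and fv f\<^sub>1 a\<^sub>0 :: "complex Matrix.vec"
  assumes "N \<ge> 1"
    and "bij_betw lam {1..N} {x. poly (legendre N) x = 0}"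
    and "bij_betw \<rho> {..<N * (2 * N + 1)} (row_indices N)"
    and "bij_betw \<kappa> {..<N\<^sup>2} (col_indices N)"
  defines "\<Phi> \<equiv> Phi N lam \<rho> \<kappa>"
    and "I\<^sub>N \<equiv> sqrt_weight_mat N lam \<rho>"
    and "\<Phi>\<^sub>1 \<equiv> I\<^sub>N * \<Phi>"
    and "fv \<equiv> sample_vec N lam \<rho> f"
    and "f\<^sub>1 \<equiv> I\<^sub>N *\<^sub>v fv"
    and "a\<^sub>0 \<equiv> mat_adjoint (I\<^sub>N * \<Phi>) *\<^sub>v f\<^sub>1"
  shows "mat_adjoint (I\<^sub>N * \<Phi>) * (I\<^sub>N * \<Phi>) = 1\<^sub>m (N\<^sup>2)
    \<and> (\<forall>a. is_arg_min (\<lambda>b. norm2 (f\<^sub>1 - \<Phi>\<^sub>1 *\<^sub>v b)) (\<lambda>b. b \<in> carrier_vec (N\<^sup>2)) a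
             \<longleftrightarrow> a = a\<^sub>0)
    \<and> (\<forall>c<N\<^sup>2. \<forall>n k'. \<kappa> c = (n, k') \<longrightarrow>
         a\<^sub>0 $ c = discrete_integral N lam (\<lambda>\<eta>. cnj (sphY n k' \<eta>) * f (sphere_point \<eta>)))
    \<and> (\<forall>r<N * (2 * N + 1). \<forall>k j. \<rho> r = (k, j) \<longrightarrow>
         (\<Phi>\<^sub>1 *\<^sub>v a\<^sub>0) $ r =
           complex_of_real (sqrt (weight N lam (k, j)))
             * discrete_integral N lam
                 (\<lambda>\<eta>. (\<Sum>n=0..N - 1. sphK n (node N lam (k, j)) \<eta>) * f (sphere_point \<eta>)))"
proof -
  interpret legendre_nodes N lam
    by unfold_locales (rule assms(2))
  define L where "L = N * (2 * N + 1)"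
  note \<rho> = assms(3)
  define w where "w r = complex_of_real (sqrt (weight N lam (\<rho> r)))" for r
  define Y where "Y c = sphY (fst (\<kappa> c)) (snd (\<kappa> c))" for c
  have \<Phi>\<^sub>1: "\<Phi>\<^sub>1 = Matrix.mat L (N\<^sup>2) (\<lambda>(r, c). w r * Y c (node N lam (\<rho> r)))"
    unfolding \<Phi>\<^sub>1_def \<Phi>_def I\<^sub>N_def sqrt_weight_mat_def Phi_def L_def [symmetric]
    by (subst mat_diag_mult_left[of _ _ "N\<^sup>2"]) (auto simp: w_def Y_def)
  have entry: "\<Phi>\<^sub>1 $$ (r, c) = w r * Y c (node N lam (\<rho> r))" if "r < L" "c < N\<^sup>2" for r c
    using that by (simp add: \<Phi>\<^sub>1)
  have carrier: "\<Phi>\<^sub>1 \<in> carrier_mat L (N\<^sup>2)"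
    by (simp add: \<Phi>\<^sub>1)
  \<comment> \<open>Each factor of a matrix product brings one root of the weight; nonnegative
    Christoffel numbers let the two recombine to the weight itself.\<close>
  have ww: "cnj (w r) * w r = complex_of_real (weight N lam (\<rho> r))" if "r < L" for r
  proof -
    have "\<rho> r \<in> row_indices N"
      using \<rho> that by (auto simp: bij_betw_def L_def)
    hence "weight N lam (\<rho> r) \<ge> 0"
      by (auto simp: weight_def row_indices_def christoffel_nonneg)
    thus ?thesis
      by (simp add: w_def flip: of_real_mult)
  qed
  have f\<^sub>1: "f\<^sub>1 = Matrix.vec L (\<lambda>r. w r * f (sphere_point (node N lam (\<rho> r))))"
    unfolding f\<^sub>1_def fv_def I\<^sub>N_def sqrt_weight_mat_def sample_vec_def L_def [symmetric]
    by (rule eq_vecI)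
      (auto simp: mat_diag_def scalar_prod_def w_def if_distrib[of "\<lambda>x. x * _"] cong: if_cong)
  have f\<^sub>1_carrier: "f\<^sub>1 \<in> carrier_vec L"
    by (simp add: f\<^sub>1)
  have a\<^sub>0_eq: "a\<^sub>0 = mat_adjoint \<Phi>\<^sub>1 *\<^sub>v f\<^sub>1"
    by (simp only: a\<^sub>0_def \<Phi>\<^sub>1_def)
  have a\<^sub>0_carrier: "a\<^sub>0 \<in> carrier_vec (N\<^sup>2)"
    unfolding a\<^sub>0_eq using mat_adjoint_carrier[OF carrier] f\<^sub>1_carrier by simp
  have col: "\<kappa> c \<in> col_indices N" if "c < N\<^sup>2" for c
    using assms(4) that by (auto simp: bij_betw_def)

  \<comment> \<open>Each entry of this Gram matrix is a discrete scalar product of two spherical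
    functions.\<close>
  have orth: "mat_adjoint \<Phi>\<^sub>1 * \<Phi>\<^sub>1 = 1\<^sub>m (N\<^sup>2)"
  proof (rule eq_matI)
    fix c c' assume "c < dim_row (1\<^sub>m (N\<^sup>2) :: complex mat)" "c' < dim_col (1\<^sub>m (N\<^sup>2) :: complex mat)"
    hence c: "c < N\<^sup>2" "c' < N\<^sup>2"
      by simp_all
    have "(mat_adjoint \<Phi>\<^sub>1 * \<Phi>\<^sub>1) $$ (c, c') = (\<Sum>r<L. mat_adjoint \<Phi>\<^sub>1 $$ (c, r) * \<Phi>\<^sub>1 $$ (r, c'))"
      using c carrier mat_adjoint_carrier[OF carrier] by (auto simp: scalar_prod_def atLeast0LessThan)
    also have "\<dots> = (\<Sum>r<L. cnj (Y c (node N lam (\<rho> r))) * Y c' (node N lam (\<rho> r))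
        * complex_of_real (weight N lam (\<rho> r)))"
      using c by (intro sum.cong refl) (simp add: index_mat_adjoint[OF carrier] entry flip: ww)
    also have "\<dots> = discrete_integral N lam (\<lambda>\<eta>. cnj (Y c \<eta>) * Y c' \<eta>)"
      unfolding L_def by (rule discrete_integral_enum[OF \<rho>, symmetric])
    also have "\<dots> = (if \<kappa> c = \<kappa> c' then 1 else 0)"
      unfolding Y_def using col[OF c(1)] col[OF c(2)]
      by (subst sphY_discrete_orthonormal) (simp_all add: prod_eq_iff)
    also have "\<kappa> c = \<kappa> c' \<longleftrightarrow> c = c'"
      using assms(4) c by (auto simp: bij_betw_def inj_on_def)
    finally show "(mat_adjoint \<Phi>\<^sub>1 * \<Phi>\<^sub>1) $$ (c, c') = 1\<^sub>m (N\<^sup>2) $$ (c, c')"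
      using c by simp
  qed (use carrier mat_adjoint_carrier[OF carrier] in auto)

  have coeff: "a\<^sub>0 $ c = discrete_integral N lam (\<lambda>\<eta>. cnj (Y c \<eta>) * f (sphere_point \<eta>))"
    if c: "c < N\<^sup>2" for c
  proof -
    have "a\<^sub>0 $ c = (\<Sum>r<L. mat_adjoint \<Phi>\<^sub>1 $$ (c, r) * f\<^sub>1 $ r)"
      unfolding a\<^sub>0_eq by (rule index_mult_mat_vec_sum[OF mat_adjoint_carrier[OF carrier] f\<^sub>1_carrier c])
    also have "\<dots> = (\<Sum>r<L. cnj (Y c (node N lam (\<rho> r))) * f (sphere_point (node N lam (\<rho> r)))
        * complex_of_real (weight N lam (\<rho> r)))"
      using c by (intro sum.cong refl) (simp add: index_mat_adjoint[OF carrier] entry f\<^sub>1 flip: ww)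
    also have "\<dots> = discrete_integral N lam (\<lambda>\<eta>. cnj (Y c \<eta>) * f (sphere_point \<eta>))"
      unfolding L_def by (rule discrete_integral_enum[OF \<rho>, symmetric])
    finally show ?thesis .
  qed

  have approx: "(\<Phi>\<^sub>1 *\<^sub>v a\<^sub>0) $ r = w r * discrete_integral N lam
      (\<lambda>\<eta>. (\<Sum>n=0..N - 1. sphK n (node N lam (\<rho> r)) \<eta>) * f (sphere_point \<eta>))"
    if r: "r < L" for r
  proof -
    define \<xi> where "\<xi> = node N lam (\<rho> r)"
    \<comment> \<open>\<open>G (n, k)\<close> is one term of the kernel at \<open>\<xi>\<close>,
      integrated against \<open>f\<close>. Reindexing along \<open>\<kappa>\<close> turns the sum
      over columns into a sum over such pairs.\<close>
    define G where "G x = (case x of (n, k) \<Rightarrow> discrete_integral N lam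
      (\<lambda>\<eta>. sphY n k \<xi> * (cnj (sphY n k \<eta>) * f (sphere_point \<eta>))))" for x
    have "(\<Phi>\<^sub>1 *\<^sub>v a\<^sub>0) $ r = (\<Sum>c<N\<^sup>2. \<Phi>\<^sub>1 $$ (r, c) * a\<^sub>0 $ c)"
      by (rule index_mult_mat_vec_sum[OF carrier a\<^sub>0_carrier r])
    also have "\<dots> = (\<Sum>c<N\<^sup>2. w r * G (\<kappa> c))"
      using r by (intro sum.cong refl)
        (simp add: entry coeff G_def Y_def \<xi>_def discrete_integral_cmult case_prod_unfold)
    also have "\<dots> = w r * (\<Sum>x\<in>col_indices N. G x)"
      unfolding sum_distrib_left [symmetric] using sum.reindex_bij_betw[OF assms(4), of G] by simp
    also have "(\<Sum>x\<in>col_indices N. G x) = (\<Sum>n<N. \<Sum>k\<in>{- int n..int n}. G (n, k))"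
      by (simp add: col_indices_def sum.Sigma)
    also have "\<dots> = discrete_integral N lam (\<lambda>\<eta>. \<Sum>n<N. \<Sum>k\<in>{- int n..int n}.
        sphY n k \<xi> * (cnj (sphY n k \<eta>) * f (sphere_point \<eta>)))"
      by (simp add: G_def discrete_integral_sum)
    \<comment> \<open>Subtraction is truncated: for \<open>N = 0\<close> the right-hand set would
      still contain 0, hence the use of \<open>N \<ge> 1\<close>.\<close>
    also have "{..<N} = {0..N - 1}"
      using \<open>N \<ge> 1\<close> by auto
    finally show ?thesis
      by (simp only: sphK_def \<xi>_def sum_distrib_right mult.assoc)
  qed

  show ?thesis
  proof (intro conjI allI impI)
    show "mat_adjoint (I\<^sub>N * \<Phi>) * (I\<^sub>N * \<Phi>) = 1\<^sub>m (N\<^sup>2)"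
      using orth by (simp only: \<Phi>\<^sub>1_def)
  next
    fix a
    show "is_arg_min (\<lambda>b. norm2 (f\<^sub>1 - \<Phi>\<^sub>1 *\<^sub>v b)) (\<lambda>b. b \<in> carrier_vec (N\<^sup>2)) a \<longleftrightarrow> a = a\<^sub>0"
      unfolding a\<^sub>0_eq by (rule is_arg_min_least_squares_iff[OF carrier orth f\<^sub>1_carrier])
  next
    fix c n k' assume "c < N\<^sup>2" "\<kappa> c = (n, k')"
    thus "a\<^sub>0 $ c = discrete_integral N lam (\<lambda>\<eta>. cnj (sphY n k' \<eta>) * f (sphere_point \<eta>))"
      by (simp add: coeff Y_def)
  next
    fix r k j assume "r < N * (2 * N + 1)" "\<rho> r = (k, j)"
    thus "(\<Phi>\<^sub>1 *\<^sub>v a\<^sub>0) $ r = complex_of_real (sqrt (weight N lam (k, j)))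
        * discrete_integral N lam
            (\<lambda>\<eta>. (\<Sum>n=0..N - 1. sphK n (node N lam (k, j)) \<eta>) * f (sphere_point \<eta>))"
      using approx[of r] by (simp add: w_def L_def)
  qed
qed

end
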